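(* Let $\Sigma$ be a finite alphabet and let $\rho\in(0,1)$. Every isometry of $(\Sigma^*,d_\rho)$ is either a character-permutation, i.e. a map $s_1\cdots s_n\mapsto\pi(s_1)\cdots\pi(s_n)$ for some permutation $\pi$ of $\Sigma$, or the composition of a character-permutation with the reversal map $R:s_1\cdots s_n\mapsto s_n\cdots s_1$.
   Context: $\Sigma$ is a finite set of characters; $\Sigma^n$ is the set of strings of length $n$ over $\Sigma$, and $\Sigma^*=\bigsqcup_{n\ge 0}\Sigma^n$. For strings $S,Q$, the multiplicity $c(S,Q)$ is the number of pairs $(P_1,P_2)$ of strings with $S=P_1QP_2$. For $n\ge 1$, $[S]_n\in\mathbb{R}^{\Sigma^n}$ is the $n$-gram count vector $[S]_n(X)=c(S,X)$ for $X\in\Sigma^n$. For vectors $u,v$ with nonnegative entries, $\theta(u,v)=\arccos\left(\frac{u\cdot v}{\|u\|\|v\|}\right)$ if $u,v\ne 0$, $\theta(u,v)=0$ if $u=v=0$, and $\theta(u,v)=\pi/2$ if exactly one of $u,v$ is $0$. Set $\theta_n(S,T)=\theta([S]_n,[T]_n)$ and $d_\rho(S,T)=\sum_{n\ge 1}\rho^n\theta_n(S,T)$, a metric on $\Sigma^*$. An isometry of $\Sigma^*$ is a bijection $\phi:\Sigma^*\to\Sigma^*$ with $d_\rho(\phi(S),\phi(T))=d_\rho(S,T)$ for all $S,T$. *)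

theory Defs
  imports "HOL-Analysis.L2_Norm"
begin

text \<open>
  The alphabet is an arbitrary finite set \<open>A\<close> of elements of a type (possibly empty);
  strings over it are the members of \<^term>\<open>lists A\<close>.
\<close>

definition strings_of_length :: "'a set \<Rightarrow> nat \<Rightarrow> 'a list set" where
  "strings_of_length A n = {X \<in> lists A. length X = n}"

definition multiplicity_in :: "'a list \<Rightarrow> 'a list \<Rightarrow> nat" where
  "multiplicity_in S Q = card {(P1, P2). S = P1 @ Q @ P2}"

text \<open>
  A vector indexed by a finite set \<open>I\<close> is a real function of which only the values on \<open>I\<close>
  are relevant; its Euclidean norm is \<^term>\<open>L2_set u I\<close>.
\<close>

definition angle :: "'i set \<Rightarrow> ('i \<Rightarrow> real) \<Rightarrow> ('i \<Rightarrow> real) \<Rightarrow> real" where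
  "angle I u v =
    (if (\<forall>i\<in>I. u i = 0) \<and> (\<forall>i\<in>I. v i = 0) then 0
     else if (\<forall>i\<in>I. u i = 0) \<or> (\<forall>i\<in>I. v i = 0) then pi / 2
     else arccos ((\<Sum>i\<in>I. u i * v i) / (L2_set u I * L2_set v I)))"

text \<open>
  The length \<open>n\<close> of the grams enters only through the index set: the vector of \<open>n\<close>-gram counts
  is the restriction of \<^term>\<open>ngram_count S\<close> to \<^term>\<open>strings_of_length A n\<close>.
\<close>

definition ngram_count :: "'a list \<Rightarrow> 'a list \<Rightarrow> real" where
  "ngram_count S = (\<lambda>X. real (multiplicity_in S X))"

definition ngram_angle :: "'a set \<Rightarrow> nat \<Rightarrow> 'a list \<Rightarrow> 'a list \<Rightarrow> real" where
  "ngram_angle A n S T = angle (strings_of_length A n) (ngram_count S) (ngram_count T)"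

text \<open>
  The sum ranges over the gram lengths \<open>n \<ge> 1\<close>, hence the shift by \<^term>\<open>Suc\<close>. For
  \<open>0 < \<rho> < 1\<close> it converges absolutely, since all angles lie between \<open>0\<close> and \<open>pi / 2\<close>.
\<close>

definition string_dist :: "'a set \<Rightarrow> real \<Rightarrow> 'a list \<Rightarrow> 'a list \<Rightarrow> real" where
  "string_dist A \<rho> S T = (\<Sum>n. \<rho> ^ Suc n * ngram_angle A (Suc n) S T)"

definition string_isometry :: "'a set \<Rightarrow> real \<Rightarrow> ('a list \<Rightarrow> 'a list) \<Rightarrow> bool" where
  "string_isometry A \<rho> \<phi> \<longleftrightarrow>
     bij_betw \<phi> (lists A) (lists A) \<and>
     (\<forall>S\<in>lists A. \<forall>T\<in>lists A. string_dist A \<rho> (\<phi> S) (\<phi> T) = string_dist A \<rho> S T)"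

definition character_permutation :: "'a set \<Rightarrow> ('a list \<Rightarrow> 'a list) \<Rightarrow> bool" where
  "character_permutation A \<psi> \<longleftrightarrow>
     (\<exists>\<pi>. bij_betw \<pi> A A \<and> (\<forall>S\<in>lists A. \<psi> S = map \<pi> S))"

end

theory Submission
  imports Defs "HOL-Library.Sublist" "HOL-Library.Multiset"
begin

text \<open>
  The distances to the empty string are partial sums of \<open>\<Sum>n. pi / 2 * \<rho> ^ Suc n\<close>, one value
  for each length, and every ball around the empty string of radius below the full sum is
  finite. A non-empty string has some infinite ball of smaller radius: if \<open>a\<close> occurs in it, then
  the powers of \<open>a\<close> all have the same \<open>1\<close>-gram angle to it, and this angle is less than
  \<open>pi / 2\<close>. Hence an isometry \<open>\<phi>\<close> fixes the empty string (\<open>isometry_fixes_Nil\<close>) and preserves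
  lengths.

  For an arbitrary \<open>\<rho>\<close> the series need not determine its individual angles, but enough of them
  can be isolated. If \<open>Q\<close> has length \<open>n\<close>, its \<open>n\<close>-gram vector is a coordinate vector and its longer gram
  vectors vanish. So, once the angles below \<open>n\<close> are known to be preserved, \<open>\<phi>\<close> preserves the
  \<open>n\<close>-gram angle between \<open>Q\<close> and any \<open>T\<close>, whose cosine is the multiplicity of \<open>Q\<close> in \<open>T\<close>
  divided by the norm of the \<open>n\<close>-gram vector of \<open>T\<close>. The sum of the \<open>n\<close>-gram counts depends
  only on the length of \<open>T\<close>, so the norm is preserved as well, and therefore also the
  multiplicity. Thus \<open>\<phi>\<close> permutes the coordinates of all \<open>n\<close>-gram vectors, all \<open>n\<close>-gram angles
  are preserved, and the argument can be repeated for \<open>n + 1\<close> (\<open>isometry_multiplicity\<close>).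

  It remains to find the bijections that preserve all multiplicities. After a permutation of
  the characters such a map fixes every single character; it then fixes or reverses each string
  of length two, and strings of length three force the same choice for all of them
  (\<open>fixes_or_reverses_pairs\<close>). After a reversal if necessary, strings of length at most two are
  fixed, and a string of length at least three is determined by the multiplicities of its
  shorter factors (\<open>eq_if_same_shorter_multiplicities\<close>).
\<close>

section \<open>Multiplicities of factors\<close>

lemma mem_strings_of_length [simp]:
  "Q \<in> strings_of_length A n \<longleftrightarrow> Q \<in> lists A \<and> length Q = n"
  by (simp add: strings_of_length_def)

lemma finite_strings_of_length [simp]:
  assumes "finite A"
  shows "finite (strings_of_length A n)"
proof -
  have "strings_of_length A n = {Q. set Q \<subseteq> A \<and> length Q = n}"
    by (auto simp: strings_of_length_def)
  then show ?thesis
    using finite_lists_length_eq[OF assms] by simp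
qed

lemma finite_factorizations: "finite {(P1, P2). S = P1 @ Q @ P2}"
proof -
  have "{(P1, P2). S = P1 @ Q @ P2} \<subseteq> {P1. prefix P1 S} \<times> {P2. suffix P2 S}"
    by (auto simp: prefix_def suffix_def)
  moreover have "{P1. prefix P1 S} = set (prefixes S)" "{P2. suffix P2 S} = set (suffixes S)"
    by auto
  ultimately show ?thesis
    by (metis finite_SigmaI finite_set finite_subset)
qed

lemma multiplicity_in_Nil: "multiplicity_in [] Q = of_bool (Q = [])"
proof -
  have "{(P1, P2). [] = P1 @ Q @ P2} = (if Q = [] then {([], [])} else {})"
    by auto
  then show ?thesis
    by (simp add: multiplicity_in_def)
qed

lemma multiplicity_in_Cons:
  "multiplicity_in (x # S) Q = multiplicity_in S Q + of_bool (prefix Q (x # S))"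
proof -
  let ?F = "{(P1, P2). S = P1 @ Q @ P2}"
  let ?B = "{([] :: 'a list, P2) | P2. x # S = Q @ P2}"
  have split: "{(P1, P2). x # S = P1 @ Q @ P2} = (\<lambda>(P1, P2). (x # P1, P2)) ` ?F \<union> ?B"
    by (auto simp: Cons_eq_append_conv image_iff)
  have B: "?B = (if prefix Q (x # S) then {([], drop (length Q) (x # S))} else {})"
    by (auto simp: prefix_def append_eq_conv_conj)
  have "card {(P1, P2). x # S = P1 @ Q @ P2}
      = card ((\<lambda>(P1, P2). (x # P1, P2)) ` ?F) + card ?B"
    unfolding split by (rule card_Un_disjoint) (auto simp: finite_factorizations B)
  also have "card ((\<lambda>(P1, P2). (x # P1, P2)) ` ?F) = card ?F"
    by (rule card_image) (auto simp: inj_on_def)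
  finally show ?thesis
    unfolding multiplicity_in_def B by simp
qed

lemma multiplicity_in_empty_factor: "multiplicity_in S [] = Suc (length S)"
  by (induction S) (simp_all add: multiplicity_in_Nil multiplicity_in_Cons)

lemma multiplicity_in_singleton: "multiplicity_in S [a] = count (mset S) a"
  by (induction S) (auto simp: multiplicity_in_Nil multiplicity_in_Cons)

lemma multiplicity_in_longer: "length S < length Q \<Longrightarrow> multiplicity_in S Q = 0"
  by (induction S) (auto simp: multiplicity_in_Nil multiplicity_in_Cons dest: prefix_length_le)

lemma multiplicity_in_same_length:
  assumes "length S = length Q"
  shows "multiplicity_in S Q = of_bool (Q = S)"
proof (cases S)
  case Nil
  then show ?thesis
    by (simp add: multiplicity_in_Nil)
next
  case (Cons x S')
  have "prefix Q S \<longleftrightarrow> Q = S"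
    using assms by (auto simp: prefix_def)
  moreover have "multiplicity_in S' Q = 0"
    using assms Cons by (intro multiplicity_in_longer) auto
  ultimately show ?thesis
    by (simp add: Cons multiplicity_in_Cons)
qed

lemma multiplicity_in_rev: "multiplicity_in (rev S) (rev Q) = multiplicity_in S Q"
proof -
  have "bij_betw (\<lambda>(P1, P2). (rev P2, rev P1))
      {(P1, P2). S = P1 @ Q @ P2} {(P1, P2). rev S = P1 @ rev Q @ P2}"
    by (rule bij_betw_byWitness[where f' = "\<lambda>(P1, P2). (rev P2, rev P1)"])
       (auto simp: rev_swap)
  then show ?thesis
    unfolding multiplicity_in_def by (metis bij_betw_same_card)
qed

lemma multiplicity_in_map:
  assumes "inj_on f A" "S \<in> lists A" "Q \<in> lists A"
  shows "multiplicity_in (map f S) (map f Q) = multiplicity_in S Q"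
  using assms(2)
proof (induction S)
  case Nil
  then show ?case
    by (simp add: multiplicity_in_Nil)
next
  case (Cons x S)
  have "prefix (map f Q) (map f (x # S)) \<longleftrightarrow> prefix Q (x # S)"
  proof
    assume "prefix (map f Q) (map f (x # S))"
    then have "map f Q = map f (take (length Q) (x # S))"
      by (metis append_eq_conv_conj length_map prefix_def take_map)
    moreover have "inj_on f (set Q \<union> set (take (length Q) (x # S)))"
    proof (rule inj_on_subset[OF assms(1)])
      have "set (x # S) \<subseteq> A" "set Q \<subseteq> A"
        using Cons.hyps assms(3) by auto
      then show "set Q \<union> set (take (length Q) (x # S)) \<subseteq> A"
        using set_take_subset[of "length Q" "x # S"] by blast
    qed
    ultimately have "Q = take (length Q) (x # S)"
      by (simp only: inj_on_map_eq_map)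
    then show "prefix Q (x # S)"
      by (metis take_is_prefix)
  qed (rule map_mono_prefix)
  then show ?case
    using Cons by (simp add: multiplicity_in_Cons)
qed

text \<open>
  An occurrence of \<open>Q\<close> is either preceded by a unique character or stands at the very start.
\<close>

lemma multiplicity_in_extend_left:
  assumes "finite A" "S \<in> lists A"
  shows "multiplicity_in S Q = (\<Sum>a\<in>A. multiplicity_in S (a # Q)) + of_bool (prefix Q S)"
  using assms(2)
proof (induction S)
  case Nil
  then show ?case
    by (simp add: multiplicity_in_Nil)
next
  case (Cons x S)
  have "(\<Sum>a\<in>A. of_bool (prefix (a # Q) (x # S)) :: nat)
      = (\<Sum>a\<in>A. if a = x then of_bool (prefix Q S) else 0)"
    by (intro sum.cong) auto
  also have "\<dots> = of_bool (prefix Q S)"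
    using Cons.hyps assms(1) by simp
  finally show ?case
    using Cons by (simp add: multiplicity_in_Cons[of x S] sum.distrib)
qed

lemma multiplicity_in_extend_right:
  assumes "finite A" "S \<in> lists A"
  shows "multiplicity_in S Q = (\<Sum>a\<in>A. multiplicity_in S (Q @ [a])) + of_bool (suffix Q S)"
proof -
  have "multiplicity_in (rev S) (a # rev Q) = multiplicity_in S (Q @ [a])" for a
    using multiplicity_in_rev[of S "Q @ [a]"] by simp
  then show ?thesis
    using multiplicity_in_extend_left[of A "rev S" "rev Q"] assms
    by (simp add: multiplicity_in_rev suffix_to_prefix in_lists_conv_set)
qed

lemma sum_multiplicity_in:
  assumes "finite A" "S \<in> lists A"
  shows "(\<Sum>Q\<in>strings_of_length A n. multiplicity_in S Q) = Suc (length S) - n"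
  using assms(2)
proof (induction S)
  case Nil
  show ?case
  proof (cases n)
    case 0
    then have "strings_of_length A n = {[]}"
      by (auto simp: strings_of_length_def)
    then show ?thesis
      using 0 by (simp add: multiplicity_in_Nil)
  next
    case (Suc m)
    then show ?thesis
      by (auto simp: multiplicity_in_Nil intro!: sum.neutral)
  qed
next
  case (Cons x S)
  let ?W = "x # S"
  have W: "set ?W \<subseteq> A"
    using Cons.hyps by auto
  have "of_bool (prefix Q ?W) = (if Q = take n ?W then of_bool (n \<le> length ?W) else (0 :: nat))"
    if "Q \<in> strings_of_length A n" for Q
  proof -
    have "prefix Q ?W \<longleftrightarrow> length Q \<le> length ?W \<and> Q = take (length Q) ?W"
      by (metis append_eq_conv_conj prefix_def prefix_length_le take_is_prefix)
    then show ?thesis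
      using that by auto
  qed
  then have "(\<Sum>Q\<in>strings_of_length A n. of_bool (prefix Q ?W))
      = (\<Sum>Q\<in>strings_of_length A n.
          if Q = take n ?W then of_bool (n \<le> length ?W) else (0 :: nat))"
    by (rule sum.cong[OF refl])
  also have "\<dots> = of_bool (n \<le> length ?W)"
  proof -
    have "n \<le> length ?W \<Longrightarrow> take n ?W \<in> strings_of_length A n"
      using W set_take_subset[of n ?W] by auto
    then show ?thesis
      by (auto simp: assms(1) sum.delta simp del: mem_strings_of_length)
  qed
  finally show ?case
    using Cons by (auto simp: multiplicity_in_Cons sum.distrib)
qed

text \<open>
  By the two extension formulas, the factors of length \<open>k\<close> and \<open>k + 1\<close> determine the prefix and
  the suffix of length \<open>k\<close>. This gives all of \<open>S\<close> except its penultimate character, which is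
  the one left over when the characters are counted. The last character is read off from
  factors of length two, whence the bound on the length; \<open>ab\<close> and \<open>ba\<close> show that it is sharp.
\<close>

lemma eq_if_same_shorter_multiplicities:
  assumes "finite A" "S \<in> lists A" "T \<in> lists A"
    and len: "length S = length T" "3 \<le> length T"
    and same: "\<And>Q. \<lbrakk>Q \<in> lists A; length Q < length T\<rbrakk> \<Longrightarrow> multiplicity_in S Q = multiplicity_in T Q"
  shows "S = T"
proof -
  have pre: "prefix Q S \<longleftrightarrow> prefix Q T" and suf: "suffix Q S \<longleftrightarrow> suffix Q T"
    if Q: "Q \<in> lists A" "Suc (length Q) < length T" for Q
  proof -
    have "multiplicity_in S Q = multiplicity_in T Q"
      using Q by (intro same) auto
    moreover have "(\<Sum>a\<in>A. multiplicity_in S (a # Q)) = (\<Sum>a\<in>A. multiplicity_in T (a # Q))"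
      and "(\<Sum>a\<in>A. multiplicity_in S (Q @ [a])) = (\<Sum>a\<in>A. multiplicity_in T (Q @ [a]))"
      using Q by (auto intro!: sum.cong same)
    ultimately have "of_bool (prefix Q S) = (of_bool (prefix Q T) :: nat)"
      and "of_bool (suffix Q S) = (of_bool (suffix Q T) :: nat)"
      using multiplicity_in_extend_left[OF assms(1,2), of Q]
        multiplicity_in_extend_left[OF assms(1,3), of Q]
        multiplicity_in_extend_right[OF assms(1,2), of Q]
        multiplicity_in_extend_right[OF assms(1,3), of Q] by linarith+
    then show "prefix Q S \<longleftrightarrow> prefix Q T" "suffix Q S \<longleftrightarrow> suffix Q T"
      by (simp_all only: of_bool_eq_iff)
  qed
  define P where "P = take (length T - 2) T"
  have P: "P \<in> lists A" "length P = length T - 2"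
    using assms(3) set_take_subset[of "length T - 2" T] by (auto simp: P_def)
  have "prefix P S"
    using pre[of P] P len by (auto simp: P_def take_is_prefix)
  then obtain X where X: "S = P @ X"
    by (auto simp: prefix_def)
  obtain Y where Y: "T = P @ Y"
    by (metis P_def append_take_drop_id)
  have "length X = 2" "length Y = 2"
    using X Y P len by (metis add_diff_cancel_left' diff_diff_cancel length_append
        less_imp_le_nat numeral_2_eq_2 numeral_3_eq_3 Suc_le_lessD order_trans)+
  then obtain x1 x2 y1 y2 where xy: "X = [x1, x2]" "Y = [y1, y2]"
    by (auto simp: numeral_2_eq_2 length_Suc_conv)
  have "suffix [y2] S"
  proof -
    have "suffix [y2] T" "y2 \<in> A"
      using assms(3) by (auto simp: Y xy suffix_def)
    then show ?thesis
      using suf[of "[y2]"] len(2) by simp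
  qed
  then have last: "x2 = y2"
    by (auto simp: X xy suffix_def)
  have "multiplicity_in S [a] = multiplicity_in T [a]" for a
  proof (cases "a \<in> A")
    case True
    then show ?thesis
      using len(2) by (intro same) auto
  next
    case False
    have "count (mset S) a = 0" "count (mset T) a = 0"
      using False assms(2,3) by (auto simp: count_mset_0_iff)
    then show ?thesis
      by (simp only: multiplicity_in_singleton)
  qed
  then have "mset S = mset T"
    by (simp add: multiplicity_in_singleton multiset_eq_iff)
  then show ?thesis
    by (simp add: X Y xy last)
qed

section \<open>Bijections that preserve multiplicities\<close>

definition preserves_multiplicity :: "'a set \<Rightarrow> ('a list \<Rightarrow> 'a list) \<Rightarrow> bool" where
  "preserves_multiplicity A f \<longleftrightarrow>
     f ` lists A \<subseteq> lists A \<and> inj_on f (lists A) \<and> (\<forall>S\<in>lists A. length (f S) = length S) \<and>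
     (\<forall>S\<in>lists A. \<forall>Q\<in>lists A. multiplicity_in (f S) (f Q) = multiplicity_in S Q)"

lemma preserves_multiplicityD:
  assumes "preserves_multiplicity A f"
  shows "S \<in> lists A \<Longrightarrow> f S \<in> lists A"
    and "S \<in> lists A \<Longrightarrow> T \<in> lists A \<Longrightarrow> f S = f T \<longleftrightarrow> S = T"
    and "S \<in> lists A \<Longrightarrow> length (f S) = length S"
    and "S \<in> lists A \<Longrightarrow> Q \<in> lists A \<Longrightarrow> multiplicity_in (f S) (f Q) = multiplicity_in S Q"
  using assms unfolding preserves_multiplicity_def inj_on_def by blast+

lemma preserves_multiplicity_comp:
  assumes "preserves_multiplicity A f" "preserves_multiplicity A g"
  shows "preserves_multiplicity A (g \<circ> f)"
  using preserves_multiplicityD[OF assms(1)] preserves_multiplicityD[OF assms(2)]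
  by (simp add: preserves_multiplicity_def inj_on_def image_subset_iff del: in_lists_conv_set)

lemma preserves_multiplicity_rev: "preserves_multiplicity A rev"
  by (auto simp: preserves_multiplicity_def multiplicity_in_rev)

lemma preserves_multiplicity_map:
  assumes "bij_betw \<pi> A A"
  shows "preserves_multiplicity A (map \<pi>)"
proof -
  have inj: "inj_on \<pi> A" and "\<And>a. a \<in> A \<Longrightarrow> \<pi> a \<in> A"
    using assms by (auto simp: bij_betw_def)
  then show ?thesis
    using multiplicity_in_map[OF inj] inj_on_map_lists[OF inj]
    by (simp add: preserves_multiplicity_def image_subset_iff in_lists_conv_set)
qed

lemma fixes_all_if_fixes_short:
  assumes "finite A" and f: "preserves_multiplicity A f"
    and short: "\<And>S. \<lbrakk>S \<in> lists A; length S \<le> 2\<rbrakk> \<Longrightarrow> f S = S"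
  shows "S \<in> lists A \<Longrightarrow> f S = S"
proof (induction S rule: length_induct)
  case (1 S)
  show ?case
  proof (cases "length S \<le> 2")
    case True
    then show ?thesis
      using short 1 by blast
  next
    case False
    show ?thesis
    proof (rule eq_if_same_shorter_multiplicities[OF assms(1)])
      fix Q assume "Q \<in> lists A" "length Q < length S"
      then show "multiplicity_in (f S) Q = multiplicity_in S Q"
        using preserves_multiplicityD(4)[OF f, of S Q] 1 by auto
    qed (use 1 False preserves_multiplicityD[OF f, of S] in auto)
  qed
qed

text \<open>
  If \<open>ab\<close> were fixed and \<open>bc\<close> reversed, for distinct characters \<open>a\<close>, \<open>b\<close> and \<open>c\<close>, then
  \<open>abc\<close> would have no possible image, since no string of length three has both \<open>ab\<close> and \<open>cb\<close> as factors.
\<close>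

lemma fixes_or_reverses_pairs:
  assumes f: "preserves_multiplicity A f"
    and letters: "\<And>a. a \<in> A \<Longrightarrow> f [a] = [a]"
  shows "(\<forall>a\<in>A. \<forall>b\<in>A. f [a, b] = [a, b]) \<or> (\<forall>a\<in>A. \<forall>b\<in>A. f [a, b] = [b, a])"
proof -
  have pair: "f [a, b] = [a, b] \<or> f [a, b] = [b, a]" if "a \<in> A" "b \<in> A" for a b
  proof -
    obtain c d where cd: "f [a, b] = [c, d]" "c \<in> A" "d \<in> A"
      using preserves_multiplicityD(1,3)[OF f, of "[a, b]"] \<open>a \<in> A\<close> \<open>b \<in> A\<close>
      by (force simp: length_Suc_conv)
    have "count (mset [c, d]) e = count (mset [a, b]) e" if "e \<in> A" for e
      using preserves_multiplicityD(4)[OF f, of "[a, b]" "[e]"] \<open>a \<in> A\<close> \<open>b \<in> A\<close> that letters cd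
      by (auto simp: multiplicity_in_singleton)
    from this[of a] this[of b] that show ?thesis
      unfolding cd by (auto split: if_splits)
  qed
  have swap: "f [b, a] = [b, a]" if "f [a, b] = [a, b]" "a \<in> A" "b \<in> A" for a b
    using pair[of b a] preserves_multiplicityD(2)[OF f, of "[a, b]" "[b, a]"] that by auto
  have step: "f [b, c] = [b, c]"
    if ab: "f [a, b] = [a, b]" "a \<noteq> b" and A: "a \<in> A" "b \<in> A" "c \<in> A" for a b c
  proof (rule ccontr)
    assume neq: "f [b, c] \<noteq> [b, c]"
    then have bc: "f [b, c] = [c, b]" "b \<noteq> c"
      using pair[of b c] A by auto
    have "a \<noteq> c"
      using swap ab A neq by auto
    obtain p q r where pqr: "f [a, b, c] = [p, q, r]"
      using preserves_multiplicityD(3)[OF f, of "[a, b, c]"] A by (auto simp: length_Suc_conv)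
    have factor: "p = x \<and> q = y \<or> q = x \<and> r = y" if "multiplicity_in [p, q, r] [x, y] \<noteq> 0" for x y
      using that by (auto simp: multiplicity_in_Cons multiplicity_in_Nil split: if_split_asm)
    have "multiplicity_in [a, b, c] [a, b] \<noteq> 0" "multiplicity_in [a, b, c] [b, c] \<noteq> 0"
      by (simp_all add: multiplicity_in_Cons)
    moreover have "multiplicity_in [p, q, r] [a, b] = multiplicity_in [a, b, c] [a, b]"
      and "multiplicity_in [p, q, r] [c, b] = multiplicity_in [a, b, c] [b, c]"
      using preserves_multiplicityD(4)[OF f, of "[a, b, c]" "[a, b]"]
        preserves_multiplicityD(4)[OF f, of "[a, b, c]" "[b, c]"] A ab bc pqr by auto
    ultimately have "multiplicity_in [p, q, r] [a, b] \<noteq> 0"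
      and "multiplicity_in [p, q, r] [c, b] \<noteq> 0"
      by simp_all
    from factor[OF this(1)] factor[OF this(2)] show False
      using ab(2) bc(2) \<open>a \<noteq> c\<close> by blast
  qed
  show ?thesis
  proof (cases "\<exists>a\<in>A. \<exists>b\<in>A. a \<noteq> b \<and> f [a, b] = [a, b]")
    case True
    then obtain a b where ab: "a \<in> A" "b \<in> A" "a \<noteq> b" "f [a, b] = [a, b]"
      by blast
    have "f [c, d] = [c, d]" if "c \<in> A" "d \<in> A" for c d
      using step[of a b] step[of b c] ab that by (cases "b = c") auto
    then show ?thesis
      by blast
  next
    case False
    then show ?thesis
      using pair by metis
  qed
qed

text \<open>
  Undoing the permutation that \<open>f\<close> induces on the characters, and the reversal if pairs are
  reversed, leaves a map that fixes all strings of length at most two.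
\<close>

lemma preserves_multiplicity_cases:
  assumes "finite A" and f: "preserves_multiplicity A f"
  obtains \<pi> where "bij_betw \<pi> A A"
    and "(\<forall>S\<in>lists A. f S = map \<pi> S) \<or> (\<forall>S\<in>lists A. f S = map \<pi> (rev S))"
proof -
  have "\<exists>b\<in>A. f [a] = [b]" if "a \<in> A" for a
    using preserves_multiplicityD(1,3)[OF f, of "[a]"] that by (auto simp: length_Suc_conv)
  then obtain \<pi> where \<pi>: "\<And>a. a \<in> A \<Longrightarrow> \<pi> a \<in> A \<and> f [a] = [\<pi> a]"
    by metis
  have "inj_on \<pi> A"
    using \<pi> preserves_multiplicityD(2)[OF f, of "[_]" "[_]"] by (fastforce intro!: inj_onI)
  moreover have "\<pi> ` A \<subseteq> A"
    using \<pi> by auto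
  ultimately have bij: "bij_betw \<pi> A A"
    using endo_inj_surj[OF \<open>finite A\<close>] by (simp add: bij_betw_def)
  define \<pi>' where "\<pi>' = inv_into A \<pi>"
  have inv: "\<pi>' (\<pi> a) = a" "\<pi> (\<pi>' a) = a" if "a \<in> A" for a
    using bij that by (auto simp: \<pi>'_def bij_betw_def f_inv_into_f)
  define g where "g = map \<pi>' \<circ> f"
  have g: "preserves_multiplicity A g"
    unfolding g_def \<pi>'_def
    by (intro preserves_multiplicity_comp f preserves_multiplicity_map bij_betw_inv_into bij)
  have f_g: "f S = map \<pi> (g S)" if "S \<in> lists A" for S
    using preserves_multiplicityD(1)[OF f that] inv by (auto simp: g_def intro!: map_idI[symmetric])
  have letters: "g [a] = [a]" if "a \<in> A" for a
    using \<pi> inv that by (simp add: g_def)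
  have fixes_all: "h S = S"
    if h: "preserves_multiplicity A h" and S: "S \<in> lists A"
      and "\<And>a. a \<in> A \<Longrightarrow> h [a] = [a]" and "\<And>a b. a \<in> A \<Longrightarrow> b \<in> A \<Longrightarrow> h [a, b] = [a, b]" for h S
  proof (rule fixes_all_if_fixes_short[OF assms(1) h _ S])
    fix T assume "T \<in> lists A" "length T \<le> 2"
    then consider "T = []" | a where "T = [a]" "a \<in> A" | a b where "T = [a, b]" "a \<in> A" "b \<in> A"
      by (cases T rule: remdups_adj.cases) auto
    then show "h T = T"
      using that(3,4) preserves_multiplicityD(3)[OF h, of "[]"] by cases auto
  qed
  from fixes_or_reverses_pairs[OF g letters] consider
      "\<And>a b. a \<in> A \<Longrightarrow> b \<in> A \<Longrightarrow> g [a, b] = [a, b]"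
    | "\<And>a b. a \<in> A \<Longrightarrow> b \<in> A \<Longrightarrow> g [a, b] = [b, a]"
    by blast
  then show thesis
  proof cases
    case 1
    then have "g S = S" if "S \<in> lists A" for S
      using fixes_all[OF g that] letters by blast
    then show thesis
      using that[OF bij] f_g by auto
  next
    case 2
    have "(rev \<circ> g) S = S" if "S \<in> lists A" for S
      using preserves_multiplicity_comp[OF g preserves_multiplicity_rev] that
      by (rule fixes_all) (simp_all add: letters 2)
    then have "g S = rev S" if "S \<in> lists A" for S
      using that by (metis comp_apply rev_rev_ident)
    then show thesis
      using that[OF bij] f_g by auto
  qed
qed

section \<open>Angles between vectors of \<open>n\<close>-gram counts\<close>

lemma angle_reindex:
  assumes "bij_betw f I I"
    and "\<And>i. i \<in> I \<Longrightarrow> u' (f i) = u i" and "\<And>i. i \<in> I \<Longrightarrow> v' (f i) = v i"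
  shows "angle I u' v' = angle I u v"
proof -
  have zero: "(\<forall>i\<in>I. w' i = 0) \<longleftrightarrow> (\<forall>i\<in>I. w i = 0)" and norm: "L2_set w' I = L2_set w I"
    if "\<forall>i\<in>I. w' (f i) = w i" for w w' :: "'a \<Rightarrow> real"
  proof -
    show "(\<forall>i\<in>I. w' i = 0) \<longleftrightarrow> (\<forall>i\<in>I. w i = 0)"
    proof -
      have "(\<forall>i\<in>I. w' i = 0) \<longleftrightarrow> (\<forall>i\<in>f ` I. w' i = 0)"
        by (simp only: bij_betw_imp_surj_on[OF assms(1)])
      also have "\<dots> \<longleftrightarrow> (\<forall>i\<in>I. w i = 0)"
        using that by simp
      finally show ?thesis .
    qed
    show "L2_set w' I = L2_set w I"
      using sum.reindex_bij_betw[OF assms(1), of "\<lambda>i. (w' i)\<^sup>2"] by (simp add: L2_set_def that)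
  qed
  have u: "\<forall>i\<in>I. u' (f i) = u i" and v: "\<forall>i\<in>I. v' (f i) = v i"
    using assms(2,3) by blast+
  have "(\<Sum>i\<in>I. u' i * v' i) = (\<Sum>i\<in>I. u i * v i)"
    using sum.reindex_bij_betw[OF assms(1), of "\<lambda>i. u' i * v' i"] by (simp add: assms(2,3))
  then show ?thesis
    unfolding angle_def zero[OF u] zero[OF v] norm[OF u] norm[OF v] by simp
qed

text \<open>
  The case \<open>v = 0\<close> is included: both sides are then \<open>pi / 2\<close>, as division by zero gives zero.
\<close>

lemma angle_axis:
  assumes "finite I" "i \<in> I" "0 < u i" and "\<And>j. j \<in> I \<Longrightarrow> j \<noteq> i \<Longrightarrow> u j = 0"
  shows "angle I u v = arccos (v i / L2_set v I)"
proof -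
  have only: "(\<Sum>j\<in>I. u j * w j) = u i * w i" for w
    using assms by (subst sum.remove[of I i]) (auto intro!: sum.neutral)
  have "\<not> (\<forall>j\<in>I. u j = 0)"
    using assms(2,3) by force
  moreover have "L2_set u I = u i"
    using only[of u] assms(3) by (simp add: L2_set_def power2_eq_square)
  moreover have "v i = 0" if "\<forall>j\<in>I. v j = 0"
    using that assms(2) by blast
  ultimately show ?thesis
    unfolding angle_def using only[of v] assms(3) by (cases "\<forall>j\<in>I. v j = 0") auto
qed

lemma abs_div_L2_set_le_1:
  assumes "finite I" "i \<in> I"
  shows "\<bar>v i / L2_set v I\<bar> \<le> 1"
proof -
  have "\<bar>v i\<bar> \<le> L2_set v I"
    using member_le_L2_set[OF assms, of "\<lambda>i. \<bar>v i\<bar>"] by (simp add: L2_set_def)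
  then show ?thesis
    by (auto simp: divide_le_eq L2_set_nonneg abs_of_nonneg)
qed

lemma angle_le:
  assumes "finite I" and u: "\<And>i. i \<in> I \<Longrightarrow> 0 \<le> u i" and v: "\<And>i. i \<in> I \<Longrightarrow> 0 \<le> v i"
  shows "angle I u v \<le> pi / 2"
proof -
  let ?q = "(\<Sum>i\<in>I. u i * v i) / (L2_set u I * L2_set v I)"
  have "(\<Sum>i\<in>I. u i * v i) = (\<Sum>i\<in>I. \<bar>u i\<bar> * \<bar>v i\<bar>)"
    using u v by (intro sum.cong) auto
  also have "\<dots> \<le> L2_set u I * L2_set v I"
    by (rule L2_set_mult_ineq)
  finally have "?q \<le> 1"
    using mult_nonneg_nonneg[OF L2_set_nonneg L2_set_nonneg, of u I v I]
    by (intro divide_le_eq_1[THEN iffD2]) linarith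
  moreover have "0 \<le> ?q"
    using u v by (intro divide_nonneg_nonneg sum_nonneg mult_nonneg_nonneg L2_set_nonneg) auto
  ultimately show ?thesis
    using arccos_le_pi2[of ?q] by (simp add: angle_def)
qed

lemma angle_commute: "angle I u v = angle I v u"
  by (auto simp: angle_def mult.commute)

lemma ngram_angle_le:
  assumes "finite A"
  shows "ngram_angle A n S T \<le> pi / 2"
  unfolding ngram_angle_def by (rule angle_le; simp add: assms ngram_count_def)

lemma ngram_count_eq_0_iff:
  assumes "finite A" "S \<in> lists A"
  shows "(\<forall>Q\<in>strings_of_length A n. ngram_count S Q = 0) \<longleftrightarrow> length S < n"
proof -
  have "(\<forall>Q\<in>strings_of_length A n. ngram_count S Q = 0)
      \<longleftrightarrow> (\<Sum>Q\<in>strings_of_length A n. multiplicity_in S Q) = 0"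
    unfolding ngram_count_def using assms(1) by (simp del: mem_strings_of_length)
  then show ?thesis
    using sum_multiplicity_in[OF assms, of n] by auto
qed

lemma ngram_angle_long:
  assumes "finite A" "S \<in> lists A" "T \<in> lists A" "length S < n"
  shows "ngram_angle A n S T = (if length T < n then 0 else pi / 2)"
  using ngram_count_eq_0_iff[OF assms(1,2), of n] ngram_count_eq_0_iff[OF assms(1,3), of n] assms(4)
  by (simp add: ngram_angle_def angle_def)

lemma ngram_angle_same_length:
  assumes "finite A" "Q \<in> lists A"
  shows "ngram_angle A (length Q) Q T
    = arccos (multiplicity_in T Q / L2_set (ngram_count T) (strings_of_length A (length Q)))"
  unfolding ngram_angle_def using assms
  by (subst angle_axis[where i = Q]) (auto simp: ngram_count_def multiplicity_in_same_length)

text \<open>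
  The distance is a finite sum, since grams longer than both strings contribute nothing.
\<close>

lemma string_dist_eq_sum:
  assumes "finite A" "S \<in> lists A" "T \<in> lists A" "length S \<le> N" "length T \<le> N"
  shows "string_dist A \<rho> S T = (\<Sum>n<N. \<rho> ^ Suc n * ngram_angle A (Suc n) S T)"
  unfolding string_dist_def
  by (rule suminf_finite) (use assms ngram_angle_long[OF assms(1-3)] in auto)

lemma string_dist_Nil:
  assumes "finite A" "T \<in> lists A"
  shows "string_dist A \<rho> [] T = (\<Sum>n<length T. \<rho> ^ Suc n * (pi / 2))"
  using assms by (subst string_dist_eq_sum[where N = "length T"]) (auto simp: ngram_angle_long)

lemma string_dist_commute: "string_dist A \<rho> S T = string_dist A \<rho> T S"
  by (simp add: string_dist_def ngram_angle_def angle_commute)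

section \<open>Isometries preserve multiplicities\<close>

text \<open>
  The distances from the empty string grow with the length towards the bound on \<open>r\<close>, so
  only finitely many lengths occur in the ball.
\<close>

lemma finite_ball_Nil:
  assumes "finite A" "0 < \<rho>" "\<rho> < 1" and r: "r < pi / 2 * (\<Sum>n. \<rho> ^ Suc n)"
  shows "finite {T \<in> lists A. string_dist A \<rho> [] T \<le> r}"
proof -
  have "summable (\<lambda>n. \<rho> ^ Suc n)"
    using assms by (simp add: summable_mult)
  then have "(\<lambda>N. pi / 2 * (\<Sum>n<N. \<rho> ^ Suc n)) \<longlonglongrightarrow> pi / 2 * (\<Sum>n. \<rho> ^ Suc n)"
    by (intro tendsto_mult tendsto_const summable_LIMSEQ)
  then have "\<forall>\<^sub>F N in sequentially. r < pi / 2 * (\<Sum>n<N. \<rho> ^ Suc n)"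
    using r by (rule order_tendstoD)
  then obtain L where L: "\<And>N. L \<le> N \<Longrightarrow> r < pi / 2 * (\<Sum>n<N. \<rho> ^ Suc n)"
    by (auto simp: eventually_sequentially)
  have "length T \<le> L" if "T \<in> lists A" "string_dist A \<rho> [] T \<le> r" for T
  proof (rule ccontr)
    assume "\<not> length T \<le> L"
    then have "r < pi / 2 * (\<Sum>n<length T. \<rho> ^ Suc n)"
      by (intro L) simp
    also have "\<dots> = string_dist A \<rho> [] T"
      unfolding string_dist_Nil[OF assms(1) that(1)] sum_distrib_left
      by (simp only: mult.commute)
    finally show False
      using that by simp
  qed
  then have "{T \<in> lists A. string_dist A \<rho> [] T \<le> r} \<subseteq> {T. set T \<subseteq> A \<and> length T \<le> L}"
    by auto
  then show ?thesis
    using finite_lists_length_le[OF assms(1)] finite_subset by blast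
qed

text \<open>
  The \<open>1\<close>-gram vectors of the powers of a character \<open>a\<close> of \<open>S\<close> all lie on one axis, at a fixed
  acute angle \<open>\<alpha>\<close> to that of \<open>S\<close>; the radius is what remains of the full sum when its first
  angle is replaced by \<open>\<alpha>\<close>.
\<close>

lemma infinite_ball:
  assumes "finite A" "0 < \<rho>" "\<rho> < 1" and S: "S \<in> lists A" "S \<noteq> []"
  obtains r where "r < pi / 2 * (\<Sum>n. \<rho> ^ Suc n)"
    and "infinite {T \<in> lists A. string_dist A \<rho> S T \<le> r}"
proof -
  define a where "a = hd S"
  have a: "a \<in> set S" "a \<in> A"
    using S by (auto simp: a_def)
  define \<alpha> where
    "\<alpha> = arccos (multiplicity_in S [a] / L2_set (ngram_count S) (strings_of_length A 1))"
  define r where "r = pi / 2 * (\<Sum>n. \<rho> ^ Suc n) - \<rho> * (pi / 2 - \<alpha>)"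
  have summable: "summable (\<lambda>n. \<rho> ^ Suc n)"
    using assms by (simp add: summable_mult)
  have angle_power: "ngram_angle A 1 (replicate m a) S = \<alpha>" if "m \<noteq> 0" for m
    unfolding ngram_angle_def \<alpha>_def
    using assms(1) a that
    by (subst angle_axis[where i = "[a]"])
       (auto simp: ngram_count_def multiplicity_in_singleton length_Suc_conv split: if_splits)
  have "0 < multiplicity_in S [a]"
    using a by (simp add: multiplicity_in_singleton)
  moreover have bound: "multiplicity_in S [a] / L2_set (ngram_count S) (strings_of_length A 1) \<le> 1"
    using abs_div_L2_set_le_1[of "strings_of_length A 1" "[a]" "ngram_count S"] assms(1) a
    by (simp add: ngram_count_def abs_le_iff)
  moreover have "0 < L2_set (ngram_count S) (strings_of_length A 1)"
  proof -
    have "L2_set (ngram_count S) (strings_of_length A 1) \<noteq> 0"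
      using ngram_count_eq_0_iff[OF assms(1) S(1), of 1] S(2) assms(1)
      by (subst L2_set_eq_0_iff) (auto simp del: mem_strings_of_length)
    then show ?thesis
      using L2_set_nonneg[of "ngram_count S" "strings_of_length A 1"] by linarith
  qed
  ultimately have "\<alpha> < arccos 0"
    unfolding \<alpha>_def by (intro arccos_less_arccos) auto
  then have \<alpha>: "\<alpha> < pi / 2"
    by simp
  have "r < pi / 2 * (\<Sum>n. \<rho> ^ Suc n)"
    unfolding r_def using assms(2) \<alpha> by (simp del: power_Suc)
  moreover have "string_dist A \<rho> S (replicate m a) \<le> r" if "m \<noteq> 0" for m
  proof -
    obtain N where N: "length S \<le> Suc N" "m \<le> Suc N"
      by (metis le_SucI max.cobounded1 max.cobounded2)
    let ?\<theta> = "\<lambda>n. ngram_angle A (Suc n) (replicate m a) S"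
    have "string_dist A \<rho> S (replicate m a) = (\<Sum>n<Suc N. \<rho> ^ Suc n * ?\<theta> n)"
      using assms(1) S a N by (subst string_dist_commute, subst string_dist_eq_sum) auto
    also have "\<dots> = \<rho> * \<alpha> + (\<Sum>n<N. \<rho> ^ Suc (Suc n) * ?\<theta> (Suc n))"
      unfolding sum.lessThan_Suc_shift using angle_power[OF that] by simp
    also have "\<dots> \<le> \<rho> * \<alpha> + (\<Sum>n<N. \<rho> ^ Suc (Suc n) * (pi / 2))"
      using assms ngram_angle_le[OF assms(1)]
      by (intro add_left_mono sum_mono mult_left_mono) auto
    also have "\<dots> = (\<Sum>n<Suc N. \<rho> ^ Suc n) * (pi / 2) - \<rho> * (pi / 2 - \<alpha>)"
      unfolding sum.lessThan_Suc_shift by (simp add: algebra_simps sum_distrib_left)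
    also have "\<dots> \<le> (\<Sum>n. \<rho> ^ Suc n) * (pi / 2) - \<rho> * (pi / 2 - \<alpha>)"
      using assms summable by (intro diff_right_mono mult_right_mono sum_le_suminf) auto
    finally show ?thesis
      by (simp add: r_def mult.commute)
  qed
  then have "(\<lambda>m. replicate (Suc m) a) ` UNIV \<subseteq> {T \<in> lists A. string_dist A \<rho> S T \<le> r}"
    using a by (auto simp: in_lists_conv_set simp del: replicate_Suc)
  moreover have "inj (\<lambda>m. replicate (Suc m) a)"
    by (rule injI) (metis length_replicate nat.inject)
  then have "infinite ((\<lambda>m. replicate (Suc m) a) ` UNIV)"
    using finite_imageD infinite_UNIV_nat by blast
  ultimately show thesis
    using that finite_subset by blast
qed

lemma isometry_fixes_Nil:
  assumes "finite A" "0 < \<rho>" "\<rho> < 1" and iso: "string_isometry A \<rho> \<phi>"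
  shows "\<phi> [] = []"
proof -
  have bij: "bij_betw \<phi> (lists A) (lists A)"
    and dist: "\<And>S T. S \<in> lists A \<Longrightarrow> T \<in> lists A \<Longrightarrow> string_dist A \<rho> (\<phi> S) (\<phi> T) = string_dist A \<rho> S T"
    using iso by (auto simp: string_isometry_def simp del: in_lists_conv_set)
  obtain S where S: "S \<in> lists A" "\<phi> S = []"
    using bij lists.Nil[of A] by (metis bij_betw_iff_bijections)
  have "S = []"
  proof (rule ccontr)
    assume "S \<noteq> []"
    then obtain r where r: "r < pi / 2 * (\<Sum>n. \<rho> ^ Suc n)"
      and inf: "infinite {T \<in> lists A. string_dist A \<rho> S T \<le> r}"
      using infinite_ball[OF assms(1-3) S(1)] by blast
    let ?B = "{T \<in> lists A. string_dist A \<rho> S T \<le> r}"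
    have "\<phi> ` ?B \<subseteq> {T \<in> lists A. string_dist A \<rho> [] T \<le> r}"
      using dist[OF S(1)] S(2) bij_betw_apply[OF bij]
      by (simp add: image_subset_iff del: in_lists_conv_set)
    moreover have "inj_on \<phi> ?B"
      using bij by (auto simp: bij_betw_def elim: inj_on_subset)
    ultimately have "finite ?B"
      using finite_ball_Nil[OF assms(1-3) r] finite_imageD finite_subset by blast
    with inf show False ..
  qed
  with S show ?thesis
    by simp
qed

lemma isometry_length:
  assumes "finite A" "0 < \<rho>" "\<rho> < 1" and iso: "string_isometry A \<rho> \<phi>" and T: "T \<in> lists A"
  shows "length (\<phi> T) = length T"
proof -
  define s where "s = (\<lambda>N. \<Sum>n<N. \<rho> ^ Suc n * (pi / 2))"
  have "strict_mono s"
    unfolding s_def using assms(2) by (simp add: strict_mono_Suc_iff)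
  have \<phi>T: "\<phi> T \<in> lists A"
    using iso T bij_betw_apply unfolding string_isometry_def by fastforce
  have "string_dist A \<rho> (\<phi> []) (\<phi> T) = string_dist A \<rho> [] T"
    using iso T by (simp add: string_isometry_def)
  then have "s (length (\<phi> T)) = s (length T)"
    unfolding isometry_fixes_Nil[OF assms(1-4)] s_def string_dist_Nil[OF assms(1) T]
      string_dist_Nil[OF assms(1) \<phi>T] .
  then show ?thesis
    using \<open>strict_mono s\<close> by (simp add: strict_mono_eq)
qed

text \<open>
  Induction on the length of \<open>Q\<close>: all the other terms in the distance between \<open>Q\<close> and \<open>T\<close> are
  already known to be preserved, those for shorter grams because \<open>\<phi>\<close> permutes their counts and
  those for longer grams because they depend on the lengths only.
\<close>

lemma isometry_multiplicity:
  assumes "finite A" "0 < \<rho>" "\<rho> < 1" and iso: "string_isometry A \<rho> \<phi>"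
  shows "\<lbrakk>Q \<in> lists A; T \<in> lists A\<rbrakk> \<Longrightarrow> multiplicity_in (\<phi> T) (\<phi> Q) = multiplicity_in T Q"
proof (induction Q arbitrary: T rule: measure_induct_rule[where f = length])
  case (less Q)
  have bij: "bij_betw \<phi> (lists A) (lists A)"
    and dist: "\<And>S T. S \<in> lists A \<Longrightarrow> T \<in> lists A \<Longrightarrow> string_dist A \<rho> (\<phi> S) (\<phi> T) = string_dist A \<rho> S T"
    using iso by (auto simp: string_isometry_def simp del: in_lists_conv_set)
  have \<phi>_lists: "\<phi> S \<in> lists A" if "S \<in> lists A" for S
    using bij that by (rule bij_betw_apply)
  have len: "length (\<phi> S) = length S" if "S \<in> lists A" for S
    using isometry_length[OF assms that] .
  have bij_n: "bij_betw \<phi> (strings_of_length A n) (strings_of_length A n)" for n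
  proof (rule bij_betw_imageI)
    show inj: "inj_on \<phi> (strings_of_length A n)"
      using bij by (auto simp: bij_betw_def strings_of_length_def elim!: inj_on_subset)
    have "\<phi> ` strings_of_length A n \<subseteq> strings_of_length A n"
      using \<phi>_lists len by (auto simp: image_subset_iff simp del: in_lists_conv_set)
    then show "\<phi> ` strings_of_length A n = strings_of_length A n"
      using inj endo_inj_surj[OF finite_strings_of_length[OF assms(1)]] by blast
  qed
  show ?case
  proof (cases "Q = [] \<or> length T < length Q")
    case True
    then show ?thesis
      using isometry_fixes_Nil[OF assms] len[OF less.prems(1)] len[OF less.prems(2)]
      by (auto simp: multiplicity_in_empty_factor multiplicity_in_longer)
  next
    case False
    define n where "n = length Q"
    have "n \<noteq> 0" "n \<le> length T"
      using False by (auto simp: n_def)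
    let ?I = "strings_of_length A n"
    have angle_n: "ngram_angle A n (\<phi> P) (\<phi> T) = ngram_angle A n P T" if P: "P \<in> ?I" for P
    proof -
      let ?N = "length T"
      let ?d = "\<lambda>k. \<rho> ^ Suc k * ngram_angle A (Suc k) P T"
      let ?d' = "\<lambda>k. \<rho> ^ Suc k * ngram_angle A (Suc k) (\<phi> P) (\<phi> T)"
      have P': "P \<in> lists A" "length P = n"
        using P by auto
      have others: "?d' k = ?d k" if "k \<noteq> n - 1" for k
      proof (cases "Suc k < n")
        case True
        have "ngram_angle A (Suc k) (\<phi> P) (\<phi> T) = ngram_angle A (Suc k) P T"
          unfolding ngram_angle_def
          by (rule angle_reindex[OF bij_n])
             (use True less P' in \<open>auto simp: ngram_count_def n_def simp del: in_lists_conv_set\<close>)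
        then show ?thesis
          by simp
      next
        case False
        then have "n < Suc k"
          using that by linarith
        then show ?thesis
          using ngram_angle_long[OF assms(1) P'(1) less.prems(2), of "Suc k"]
            ngram_angle_long[OF assms(1) \<phi>_lists[OF P'(1)] \<phi>_lists[OF less.prems(2)], of "Suc k"]
            len P' less.prems by simp
      qed
      have "(\<Sum>k<?N. ?d' k) = (\<Sum>k<?N. ?d k)"
        using dist[OF P'(1) less.prems(2)] P' less.prems \<open>n \<le> length T\<close>
          string_dist_eq_sum[OF assms(1) P'(1) less.prems(2), of ?N \<rho>]
          string_dist_eq_sum[OF assms(1) \<phi>_lists[OF P'(1)] \<phi>_lists[OF less.prems(2)], of ?N \<rho>] len
        by simp
      moreover have "n - 1 \<in> {..<?N}"
        using \<open>n \<noteq> 0\<close> \<open>n \<le> length T\<close> by simp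
      moreover have "(\<Sum>k\<in>{..<?N} - {n - 1}. ?d' k) = (\<Sum>k\<in>{..<?N} - {n - 1}. ?d k)"
        using others by (intro sum.cong) auto
      ultimately have "?d' (n - 1) = ?d (n - 1)"
        by (simp add: sum.remove[of "{..<?N}" "n - 1"])
      then show ?thesis
        using \<open>n \<noteq> 0\<close> assms(2) by simp
    qed
    define w where "w = L2_set (ngram_count T) ?I"
    define w' where "w' = L2_set (ngram_count (\<phi> T)) ?I"
    have ratio: "multiplicity_in (\<phi> T) (\<phi> P) / w' = multiplicity_in T P / w" if P: "P \<in> ?I" for P
    proof (rule arccos_eq_iff[THEN iffD1])
      have \<phi>P: "\<phi> P \<in> ?I"
        using P bij_n bij_betw_apply by metis
      show "arccos (multiplicity_in (\<phi> T) (\<phi> P) / w') = arccos (multiplicity_in T P / w)"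
        using angle_n[OF P] ngram_angle_same_length[OF assms(1), of P T]
          ngram_angle_same_length[OF assms(1), of "\<phi> P" "\<phi> T"] P \<phi>P
        by (simp add: w_def w'_def)
      show "\<bar>multiplicity_in (\<phi> T) (\<phi> P) / w'\<bar> \<le> 1 \<and> \<bar>multiplicity_in T P / w\<bar> \<le> 1"
        using abs_div_L2_set_le_1[of ?I P "ngram_count T"] P \<phi>P assms(1)
          abs_div_L2_set_le_1[of ?I "\<phi> P" "ngram_count (\<phi> T)"]
        by (simp add: w_def w'_def ngram_count_def)
    qed
    have total: "(\<Sum>P\<in>?I. real (multiplicity_in S P)) = real (Suc (length S) - n)"
      if "S \<in> lists A" for S
      using sum_multiplicity_in[OF assms(1) that, of n] by (metis of_nat_sum)
    have "real (Suc (length T) - n) / w' = (\<Sum>P\<in>?I. multiplicity_in (\<phi> T) P / w')"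
      using total[OF \<phi>_lists[OF less.prems(2)]] len[OF less.prems(2)]
      by (simp add: sum_divide_distrib[symmetric])
    also have "\<dots> = (\<Sum>P\<in>?I. multiplicity_in (\<phi> T) (\<phi> P) / w')"
      by (rule sum.reindex_bij_betw[OF bij_n, symmetric])
    also have "\<dots> = (\<Sum>P\<in>?I. multiplicity_in T P / w)"
      using ratio by (rule sum.cong[OF refl])
    also have "\<dots> = real (Suc (length T) - n) / w"
      using total[OF less.prems(2)] by (simp add: sum_divide_distrib[symmetric])
    finally have "w' = w"
      using \<open>n \<le> length T\<close> by (simp add: divide_inverse)
    moreover have "w \<noteq> 0"
      unfolding w_def using assms(1) \<open>n \<le> length T\<close> ngram_count_eq_0_iff[OF assms(1) less.prems(2), of n]
      by (subst L2_set_eq_0_iff) (auto simp del: mem_strings_of_length)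
    ultimately show ?thesis
      using ratio[of Q] less.prems by (simp add: n_def)
  qed
qed

lemma isometry_preserves_multiplicity:
  assumes "finite A" "0 < \<rho>" "\<rho> < 1" and "string_isometry A \<rho> \<phi>"
  shows "preserves_multiplicity A \<phi>"
  using assms(4) isometry_length[OF assms] isometry_multiplicity[OF assms]
  by (auto simp: preserves_multiplicity_def string_isometry_def bij_betw_def
      simp del: in_lists_conv_set)

theorem theorem7p24:
  fixes A :: "'a set" and \<rho> :: real and \<phi> :: "'a list \<Rightarrow> 'a list"
  assumes "finite A"
    and "0 < \<rho>" and "\<rho> < 1"
    and "string_isometry A \<rho> \<phi>"
  shows "character_permutation A \<phi> \<or>
    (\<exists>\<psi>. character_permutation A \<psi> \<and> (\<forall>S\<in>lists A. \<phi> S = (\<psi> \<circ> rev) S))"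
proof -
  obtain \<pi> where \<pi>: "bij_betw \<pi> A A"
    and "(\<forall>S\<in>lists A. \<phi> S = map \<pi> S) \<or> (\<forall>S\<in>lists A. \<phi> S = map \<pi> (rev S))"
    using preserves_multiplicity_cases[OF assms(1) isometry_preserves_multiplicity[OF assms]]
    by blast
  then consider "\<forall>S\<in>lists A. \<phi> S = map \<pi> S" | "\<forall>S\<in>lists A. \<phi> S = (map \<pi> \<circ> rev) S"
    by auto
  then show ?thesis
  proof cases
    case 1
    with \<pi> show ?thesis
      unfolding character_permutation_def by blast
  next
    case 2
    moreover have "character_permutation A (map \<pi>)"
      using \<pi> by (auto simp: character_permutation_def)
    ultimately show ?thesis
      by blast
  qed
qed

end
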